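(* Let $\varepsilon\in\{+,-\}$ and let $\nabla$ be an $h$-connection of $E$ such that the topological holonomy group $G_{\hat\nabla,\varepsilon}$ has a noncommutative pair $(\hat C_1,\hat C_2)$ (elements $\hat C_1,\hat C_2\in G_{\hat\nabla,\varepsilon}$ with $\hat C_1\hat C_2\neq\hat C_2\hat C_1$) satisfying $\infty=\mathrm{ord}(\hat C_1)\ge\mathrm{ord}(\hat C_2)\ge3$. Then $G_{\hat\nabla,\varepsilon}$ is a dense subset of $SO(3)$.
   Context: Let $T^2=S^1\times S^1$ with $S^1=\mathbb{R}/2\pi\mathbb{Z}$ and let $\mathrm{pr}:\mathbb{R}^2\to T^2$ be the projection. $E$ is an oriented real vector bundle of rank 4 over $T^2$ with a positive-definite metric $h$. An $h$-connection is a connection $\nabla$ of $E$ with $\nabla h=0$. $\bigwedge^2E$ with the induced metric $\hat h$ decomposes into rank 3 subbundles $\bigwedge^2_+E\oplus\bigwedge^2_-E$: for a local positively oriented orthonormal frame $(e_1,e_2,e_3,e_4)$ of $E$, $\bigwedge^2_\pm E$ has the local orthonormal frame $\Omega_{\pm,1}=\frac1{\sqrt2}(e_1\wedge e_2\pm e_3\wedge e_4)$, $\Omega_{\pm,2}=\frac1{\sqrt2}(e_1\wedge e_3\pm e_4\wedge e_2)$, $\Omega_{\pm,3}=\frac1{\sqrt2}(e_1\wedge e_4\pm e_2\wedge e_3)$, and is oriented by it. $\nabla$ induces an $\hat h$-connection $\hat\nabla$ of $\bigwedge^2E$, which restricts to $\bigwedge^2_\pm E$. For $\varepsilon\in\{+,-\}$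 fix a positively oriented orthonormal basis $(\omega_{\varepsilon,1},\omega_{\varepsilon,2},\omega_{\varepsilon,3})$ of the fiber of $\bigwedge^2_\varepsilon E$ at $\mathrm{pr}(0,0)$. Let $\tilde\Omega_{\varepsilon,i,x}$ (resp. $\tilde\Omega_{\varepsilon,i,y}$) be the $\hat\nabla$-parallel sections of $\mathrm{pr}^*\bigwedge^2_\varepsilon E$ along the $x$-axis (resp. $y$-axis) with value $\omega_{\varepsilon,i}$ at $(0,0)$. Identifying the fibers of the pull-back at $(x+2\pi m,y+2\pi n)$ and $(x,y)$ for $m,n\in\mathbb{Z}$, there are $C_{\varepsilon,1},C_{\varepsilon,2}\in SO(3)$ such that for all $a,b\in\mathbb{R}$: $(\tilde\Omega_{\varepsilon,i,x}(a+2\pi,0))_{i=1,2,3}=(\tilde\Omega_{\varepsilon,i,x}(a,0))_{i=1,2,3}\,C_{\varepsilon,1}$ and $(\tilde\Omega_{\varepsilon,i,y}(0,b+2\pi))_{i=1,2,3}=(\tilde\Omega_{\varepsilon,i,y}(0,b))_{i=1,2,3}\,C_{\varepsilon,2}$ (row vectors times matrices). The topological holonomy group $G_{\hat\nabla,\varepsilon}$ of $\hat\nabla$ in $\bigwedge^2_\varepsilon E$ at $\mathrm{pr}(0,0)$ is the subgroup of $SO(3)$ generated by $C_{\varepsilon,1},C_{\varepsilon,2}$. $\mathrm{ord}$ denotes the order of a group element, with values in $\mathbb{N}\cup\{\infty\}$. *)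

theory Defs
  imports
    "HOL-Analysis.Analysis"
    "HOL-Algebra.Multiplicative_Group"
    "HOL-Library.Extended_Nat"
begin

section \<open>The torus\<close>

quotient_type circle = real / "\<lambda>x y. \<exists>k::int. y = x + 2 * pi * of_int k"
proof (rule equivpI)
  show "reflp (\<lambda>x y. \<exists>k::int. y = x + 2 * pi * of_int k)"
    by (rule reflpI) (rule exI[of _ 0], simp)
  show "symp (\<lambda>x y. \<exists>k::int. y = x + 2 * pi * of_int k)"
  proof (rule sympI, elim exE)
    fix x y :: real and k :: int assume "y = x + 2 * pi * of_int k"
    then show "\<exists>k::int. x = y + 2 * pi * of_int k"
      by (intro exI[of _ "- k"]) simp
  qed
  show "transp (\<lambda>x y. \<exists>k::int. y = x + 2 * pi * of_int k)"
  proof (rule transpI, elim exE)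
    fix x y z :: real and k l :: int
    assume "y = x + 2 * pi * of_int k" "z = y + 2 * pi * of_int l"
    then show "\<exists>k::int. z = x + 2 * pi * of_int k"
      by (intro exI[of _ "k + l"]) (simp add: algebra_simps)
  qed
qed

instantiation circle :: topological_space
begin

text \<open>The quotient topology.\<close>
definition open_circle :: "circle set \<Rightarrow> bool" where
  "open_circle U \<longleftrightarrow> open (abs_circle -` U)"

instance
proof
  show "open (UNIV :: circle set)"
    by (simp add: open_circle_def)
  show "open (S \<inter> T)" if "open S" "open T" for S T :: "circle set"
    using that by (simp add: open_circle_def vimage_Int open_Int)
  show "open (\<Union>K)" if "\<forall>S\<in>K. open S" for K :: "circle set set"
    using that by (simp add: open_circle_def vimage_Union open_UN)
qed

end

type_synonym torus = "circle \<times> circle"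

definition pr :: "real \<times> real \<Rightarrow> torus" where
  "pr q = (abs_circle (fst q), abs_circle (snd q))"

text \<open>
  The torus carries the smooth structure for which \<^term>\<open>pr\<close> is a local diffeomorphism: a function
  on an open subset of the torus is smooth iff its lift to the plane is. The tangent bundle is
  trivialised by the coordinate fields, so a vector field is a function into the plane.
\<close>

fun Ck_on :: "nat \<Rightarrow> (real \<times> real) set \<Rightarrow> (real \<times> real \<Rightarrow> real) \<Rightarrow> bool" where
  "Ck_on 0 S f \<longleftrightarrow> continuous_on S f"
| "Ck_on (Suc k) S f \<longleftrightarrow>
     (\<exists>fx fy. (\<forall>p\<in>S. (f has_derivative (\<lambda>(a, b). a * fx p + b * fy p)) (at p)) \<and>
        Ck_on k S fx \<and> Ck_on k S fy)"

definition smooth_on :: "torus set \<Rightarrow> (torus \<Rightarrow> real) \<Rightarrow> bool" where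
  "smooth_on U f \<longleftrightarrow> (\<forall>k. Ck_on k (pr -` U) (f \<circ> pr))"

type_synonym vfield = "torus \<Rightarrow> real \<times> real"

definition smooth_vfield :: "vfield \<Rightarrow> bool" where
  "smooth_vfield X \<longleftrightarrow> smooth_on UNIV (fst \<circ> X) \<and> smooth_on UNIV (snd \<circ> X)"

text \<open>The derivative of \<^term>\<open>f\<close> along \<^term>\<open>X\<close> at the point \<^term>\<open>pr q\<close>.\<close>
definition lie :: "vfield \<Rightarrow> (torus \<Rightarrow> real) \<Rightarrow> real \<times> real \<Rightarrow> real" where
  "lie X f q = frechet_derivative (f \<circ> pr) (at q) (X (pr q))"


section \<open>Vector bundles over the torus\<close>

text \<open>
  The fibers are linear subspaces of one real vector space \<^typ>\<open>'v\<close>, which only serves to provide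
  the fiberwise operations: it has no topology and unrelated fibers may intersect in any way, so
  an arbitrary family of vector spaces occurs up to isomorphism (inside its direct sum). The total
  space is the disjoint union of the fibers; its smooth structure is given by an atlas of local
  frames, i.e. of local trivialisations, indexed by a finite set whose cardinality is the rank.
\<close>
record ('i, 'v) vbundle =
  Index :: "'i set"
  Fiber :: "torus \<Rightarrow> 'v set"
  Frames :: "(torus set \<times> ('i \<Rightarrow> torus \<Rightarrow> 'v)) set"

definition is_basis :: "'i set \<Rightarrow> ('i \<Rightarrow> 'v::real_vector) \<Rightarrow> 'v set \<Rightarrow> bool" where
  "is_basis I e V \<longleftrightarrow> inj_on e I \<and> independent (e ` I) \<and> span (e ` I) = V"

definition vector_bundle :: "('i, 'v::real_vector) vbundle \<Rightarrow> bool" where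
  "vector_bundle E \<longleftrightarrow>
     finite (Index E) \<and>
     (\<forall>(U, e)\<in>Frames E. open U \<and> (\<forall>p\<in>U. is_basis (Index E) (\<lambda>i. e i p) (Fiber E p))) \<and>
     (\<forall>p. \<exists>(U, e)\<in>Frames E. p \<in> U) \<and>
     (\<forall>(U, e)\<in>Frames E. \<forall>(V, f)\<in>Frames E. \<exists>g.
        (\<forall>i\<in>Index E. \<forall>j\<in>Index E. smooth_on (U \<inter> V) (g i j)) \<and>
        (\<forall>p\<in>U \<inter> V. \<forall>j\<in>Index E. f j p = (\<Sum>i\<in>Index E. g i j p *\<^sub>R e i p)))"

definition same_orientation :: "('n::finite \<Rightarrow> 'v::real_vector) \<Rightarrow> ('n \<Rightarrow> 'v) \<Rightarrow> bool" where
  "same_orientation e f \<longleftrightarrow>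
     (\<exists>A :: real^'n^'n. det A > 0 \<and> (\<forall>j. f j = (\<Sum>i\<in>UNIV. A $ i $ j *\<^sub>R e i)))"

text \<open>The orientation is the one for which all frames of the atlas are positive.\<close>
definition oriented_vector_bundle :: "('n::finite, 'v::real_vector) vbundle \<Rightarrow> bool" where
  "oriented_vector_bundle E \<longleftrightarrow>
     vector_bundle E \<and> Index E = UNIV \<and>
     (\<forall>(U, e)\<in>Frames E. \<forall>(V, f)\<in>Frames E. \<forall>p\<in>U \<inter> V.
        same_orientation (\<lambda>i. e i p) (\<lambda>i. f i p))"

definition smooth_section :: "('i, 'v::real_vector) vbundle \<Rightarrow> (torus \<Rightarrow> 'v) \<Rightarrow> bool" where
  "smooth_section E s \<longleftrightarrow>
     (\<forall>p. s p \<in> Fiber E p) \<and>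
     (\<forall>(U, e)\<in>Frames E. \<exists>c. (\<forall>i\<in>Index E. smooth_on U (c i)) \<and>
        (\<forall>p\<in>U. s p = (\<Sum>i\<in>Index E. c i p *\<^sub>R e i p)))"

definition bilinear_form_on :: "'v::real_vector set \<Rightarrow> ('v \<Rightarrow> 'v \<Rightarrow> real) \<Rightarrow> bool" where
  "bilinear_form_on V b \<longleftrightarrow>
     (\<forall>u\<in>V. \<forall>v\<in>V. \<forall>w\<in>V. \<forall>a.
        b (u + v) w = b u w + b v w \<and> b (a *\<^sub>R u) w = a * b u w \<and>
        b w (u + v) = b w u + b w v \<and> b w (a *\<^sub>R u) = a * b w u)"

definition bundle_metric ::
    "('i, 'v::real_vector) vbundle \<Rightarrow> (torus \<Rightarrow> 'v \<Rightarrow> 'v \<Rightarrow> real) \<Rightarrow> bool" where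
  "bundle_metric E h \<longleftrightarrow>
     (\<forall>p. bilinear_form_on (Fiber E p) (h p) \<and>
        (\<forall>u\<in>Fiber E p. \<forall>v\<in>Fiber E p. h p u v = h p v u) \<and>
        (\<forall>u\<in>Fiber E p. u \<noteq> 0 \<longrightarrow> h p u u > 0)) \<and>
     (\<forall>s t. smooth_section E s \<longrightarrow> smooth_section E t \<longrightarrow>
        smooth_on UNIV (\<lambda>p. h p (s p) (t p)))"

definition bundle_connection ::
    "('i, 'v::real_vector) vbundle \<Rightarrow> (vfield \<Rightarrow> (torus \<Rightarrow> 'v) \<Rightarrow> torus \<Rightarrow> 'v) \<Rightarrow> bool" where
  "bundle_connection E D \<longleftrightarrow>
     (\<forall>X s. smooth_vfield X \<longrightarrow> smooth_section E s \<longrightarrow> smooth_section E (D X s)) \<and>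
     (\<forall>X Y s. smooth_vfield X \<longrightarrow> smooth_vfield Y \<longrightarrow> smooth_section E s \<longrightarrow>
        D (\<lambda>p. X p + Y p) s = (\<lambda>p. D X s p + D Y s p)) \<and>
     (\<forall>f X s. smooth_on UNIV f \<longrightarrow> smooth_vfield X \<longrightarrow> smooth_section E s \<longrightarrow>
        D (\<lambda>p. f p *\<^sub>R X p) s = (\<lambda>p. f p *\<^sub>R D X s p)) \<and>
     (\<forall>X s t. smooth_vfield X \<longrightarrow> smooth_section E s \<longrightarrow> smooth_section E t \<longrightarrow>
        D X (\<lambda>p. s p + t p) = (\<lambda>p. D X s p + D X t p)) \<and>
     (\<forall>f X s. smooth_on UNIV f \<longrightarrow> smooth_vfield X \<longrightarrow> smooth_section E s \<longrightarrow>
        (\<forall>q. D X (\<lambda>p. f p *\<^sub>R s p) (pr q) = lie X f q *\<^sub>R s (pr q) + f (pr q) *\<^sub>R D X s (pr q)))"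

definition metric_connection ::
    "('i, 'v::real_vector) vbundle \<Rightarrow> (torus \<Rightarrow> 'v \<Rightarrow> 'v \<Rightarrow> real) \<Rightarrow>
     (vfield \<Rightarrow> (torus \<Rightarrow> 'v) \<Rightarrow> torus \<Rightarrow> 'v) \<Rightarrow> bool" where
  "metric_connection E h D \<longleftrightarrow>
     bundle_connection E D \<and>
     (\<forall>X s t. smooth_vfield X \<longrightarrow> smooth_section E s \<longrightarrow> smooth_section E t \<longrightarrow>
        (\<forall>q. lie X (\<lambda>p. h p (s p) (t p)) q =
           h (pr q) (D X s (pr q)) (t (pr q)) + h (pr q) (s (pr q)) (D X t (pr q))))"

text \<open>
  A section of \<open>pr\<^sup>*E\<close> along a curve \<^term>\<open>c\<close> in the plane is a function \<^term>\<open>\<sigma>\<close> with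
  \<^term>\<open>\<sigma> t \<in> Fiber E (pr (c t))\<close>, so that the fibers over points of the plane that differ by a period
  are identified. Locally such a section is a combination of global sections of the bundle
  restricted to the curve, and its covariant derivative is determined by the Leibniz rule,
  independently of the combination chosen. Here \<^term>\<open>w\<close> is the covariant derivative at \<^term>\<open>t\<close>.
\<close>
definition has_covariant_derivative ::
    "('i, 'v::real_vector) vbundle \<Rightarrow> (vfield \<Rightarrow> (torus \<Rightarrow> 'v) \<Rightarrow> torus \<Rightarrow> 'v) \<Rightarrow>
     (real \<Rightarrow> real \<times> real) \<Rightarrow> (real \<Rightarrow> 'v) \<Rightarrow> 'v \<Rightarrow> real \<Rightarrow> bool" where
  "has_covariant_derivative E D c \<sigma> w t \<longleftrightarrow>
     (\<exists>(n::nat) s a a'.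
        (\<forall>k<n. smooth_section E (s k) \<and> (a k has_real_derivative a' k) (at t)) \<and>
        (\<forall>\<^sub>F u in nhds t. \<sigma> u = (\<Sum>k<n. a k u *\<^sub>R s k (pr (c u)))) \<and>
        w = (\<Sum>k<n. a' k *\<^sub>R s k (pr (c t)) +
               a k t *\<^sub>R D (\<lambda>_. vector_derivative c (at t)) (s k) (pr (c t))))"

definition parallel_along ::
    "('i, 'v::real_vector) vbundle \<Rightarrow> (vfield \<Rightarrow> (torus \<Rightarrow> 'v) \<Rightarrow> torus \<Rightarrow> 'v) \<Rightarrow>
     (real \<Rightarrow> real \<times> real) \<Rightarrow> (real \<Rightarrow> 'v) \<Rightarrow> bool" where
  "parallel_along E D c \<sigma> \<longleftrightarrow>
     (\<forall>t. \<sigma> t \<in> Fiber E (pr (c t)) \<and> has_covariant_derivative E D c \<sigma> 0 t)"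


section \<open>The exterior square\<close>

text \<open>
  The exterior square of a vector space consists of formal sums \<open>\<Sum> u\<^sub>k \<and> v\<^sub>k\<close>, represented by lists of
  pairs; two of them are equal iff no alternating bilinear form distinguishes them. For a subspace
  \<open>V\<close> of \<open>'v\<close>, the exterior square of \<open>V\<close> is the span of the \<open>u \<and> v\<close> with \<open>u, v \<in> V\<close>.
\<close>

definition alternating_form :: "('v::real_vector \<Rightarrow> 'v \<Rightarrow> real) \<Rightarrow> bool" where
  "alternating_form \<beta> \<longleftrightarrow> bilinear \<beta> \<and> (\<forall>u. \<beta> u u = 0)"

definition pairing :: "('v \<Rightarrow> 'v \<Rightarrow> real) \<Rightarrow> ('v \<times> 'v) list \<Rightarrow> real" where
  "pairing \<beta> us = sum_list (map (\<lambda>(u, v). \<beta> u v) us)"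

lemma pairing_simps [simp]:
  "pairing \<beta> [] = 0"
  "pairing \<beta> (x # us) = \<beta> (fst x) (snd x) + pairing \<beta> us"
  "pairing \<beta> (us @ vs) = pairing \<beta> us + pairing \<beta> vs"
  by (auto simp: pairing_def split_beta)

lemma pairing_scale:
  assumes "alternating_form \<beta>"
  shows "pairing \<beta> (map (\<lambda>(u, v). (a *\<^sub>R u, v)) us) = a * pairing \<beta> us"
  using assms
  by (induction us) (auto simp: alternating_form_def bilinear_lmul algebra_simps)

quotient_type (overloaded) 'v ext2 = "('v::real_vector \<times> 'v) list" /
  "\<lambda>us vs. \<forall>\<beta>. alternating_form \<beta> \<longrightarrow> pairing \<beta> us = pairing \<beta> vs"
  by (intro equivpI reflpI sympI transpI) auto

lift_definition wedge :: "'v::real_vector \<Rightarrow> 'v \<Rightarrow> 'v ext2"  (infixr "\<and>\<^sub>e" 72)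
  is "\<lambda>u v. [(u, v)]" .

instantiation ext2 :: (real_vector) real_vector
begin

lift_definition zero_ext2 :: "'a ext2" is "[]" .

lift_definition plus_ext2 :: "'a ext2 \<Rightarrow> 'a ext2 \<Rightarrow> 'a ext2" is "(@)"
  by simp

lift_definition scaleR_ext2 :: "real \<Rightarrow> 'a ext2 \<Rightarrow> 'a ext2"
  is "\<lambda>a. map (\<lambda>(u, v). (a *\<^sub>R u, v))"
  by (simp add: pairing_scale)

definition uminus_ext2 :: "'a ext2 \<Rightarrow> 'a ext2" where
  "uminus_ext2 B = (-1) *\<^sub>R B"

definition minus_ext2 :: "'a ext2 \<Rightarrow> 'a ext2 \<Rightarrow> 'a ext2" where
  "minus_ext2 B C = B + - C"

instance
proof
  fix A B C :: "'a ext2" and a b :: real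
  show "A + B + C = A + (B + C)" by transfer simp
  show "A + B = B + A" by transfer simp
  show "0 + A = A" by transfer simp
  show "- A + A = 0" unfolding uminus_ext2_def
    by transfer (simp add: pairing_scale[of _ "-1", simplified])
  show "A - B = A + - B" by (rule minus_ext2_def)
  show "a *\<^sub>R (A + B) = a *\<^sub>R A + a *\<^sub>R B" by transfer (simp add: pairing_scale distrib_left distrib_right)
  show "(a + b) *\<^sub>R A = a *\<^sub>R A + b *\<^sub>R A" by transfer (simp add: pairing_scale distrib_left distrib_right)
  show "a *\<^sub>R b *\<^sub>R A = (a * b) *\<^sub>R A"
    by transfer (simp add: pairing_scale del: map_map)
  show "1 *\<^sub>R A = A" by transfer (simp add: pairing_scale)
qed

end

definition ext2_bundle ::
    "('i::linorder, 'v::real_vector) vbundle \<Rightarrow> ('i \<times> 'i, 'v ext2) vbundle" where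
  "ext2_bundle E =
     \<lparr> Index = {(i, j). i \<in> Index E \<and> j \<in> Index E \<and> i < j},
       Fiber = (\<lambda>p. span {u \<and>\<^sub>e v |u v. u \<in> Fiber E p \<and> v \<in> Fiber E p}),
       Frames = (\<lambda>(U, e). (U, \<lambda>(i, j) p. e i p \<and>\<^sub>e e j p)) ` Frames E \<rparr>"

text \<open>The two conditions determine the induced metric on every fiber of the exterior square.\<close>
definition induced_metric ::
    "('i::linorder, 'v::real_vector) vbundle \<Rightarrow> (torus \<Rightarrow> 'v \<Rightarrow> 'v \<Rightarrow> real) \<Rightarrow>
     (torus \<Rightarrow> 'v ext2 \<Rightarrow> 'v ext2 \<Rightarrow> real) \<Rightarrow> bool" where
  "induced_metric E h hh \<longleftrightarrow>
     (\<forall>p. bilinear_form_on (Fiber (ext2_bundle E) p) (hh p) \<and>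
        (\<forall>u\<in>Fiber E p. \<forall>v\<in>Fiber E p. \<forall>u'\<in>Fiber E p. \<forall>v'\<in>Fiber E p.
           hh p (u \<and>\<^sub>e v) (u' \<and>\<^sub>e v') = h p u u' * h p v v' - h p u v' * h p v u'))"

text \<open>Likewise for the induced connection on smooth fields and sections.\<close>
definition induced_connection ::
    "('i::linorder, 'v::real_vector) vbundle \<Rightarrow>
     (vfield \<Rightarrow> (torus \<Rightarrow> 'v) \<Rightarrow> torus \<Rightarrow> 'v) \<Rightarrow>
     (vfield \<Rightarrow> (torus \<Rightarrow> 'v ext2) \<Rightarrow> torus \<Rightarrow> 'v ext2) \<Rightarrow> bool" where
  "induced_connection E D DD \<longleftrightarrow>
     bundle_connection (ext2_bundle E) DD \<and>
     (\<forall>X s t. smooth_vfield X \<longrightarrow> smooth_section E s \<longrightarrow> smooth_section E t \<longrightarrow>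
        DD X (\<lambda>p. s p \<and>\<^sub>e t p) = (\<lambda>p. D X s p \<and>\<^sub>e t p + s p \<and>\<^sub>e D X t p))"


section \<open>Self-dual and anti-self-dual bivectors\<close>

text \<open>In the numeral types used as index types, \<open>4 = 0\<close> and \<open>3 = 0\<close>; the indices are \<open>1, \<dots>, 4\<close> and
  \<open>1, 2, 3\<close>.\<close>

definition orthonormal :: "('v \<Rightarrow> 'v \<Rightarrow> real) \<Rightarrow> ('i \<Rightarrow> 'v) \<Rightarrow> bool" where
  "orthonormal b e \<longleftrightarrow> (\<forall>i j. b (e i) (e j) = (if i = j then 1 else 0))"

definition positive_onb ::
    "('n::finite, 'v::real_vector) vbundle \<Rightarrow> (torus \<Rightarrow> 'v \<Rightarrow> 'v \<Rightarrow> real) \<Rightarrow> torus \<Rightarrow>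
     ('n \<Rightarrow> 'v) \<Rightarrow> bool" where
  "positive_onb E h p e \<longleftrightarrow>
     (\<forall>i. e i \<in> Fiber E p) \<and> orthonormal (h p) e \<and>
     (\<exists>(U, f)\<in>Frames E. p \<in> U \<and> same_orientation (\<lambda>i. f i p) e)"

text \<open>The sign \<open>\<epsilon>\<close> is represented by \<open>1\<close> or \<open>-1\<close>.\<close>
definition Omega :: "real \<Rightarrow> (4 \<Rightarrow> 'v::real_vector) \<Rightarrow> 3 \<Rightarrow> 'v ext2" where
  "Omega \<epsilon> e i = (1 / sqrt 2) *\<^sub>R
     (if i = 1 then e 1 \<and>\<^sub>e e 2 + \<epsilon> *\<^sub>R (e 3 \<and>\<^sub>e e 4)
      else if i = 2 then e 1 \<and>\<^sub>e e 3 + \<epsilon> *\<^sub>R (e 4 \<and>\<^sub>e e 2)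
      else e 1 \<and>\<^sub>e e 4 + \<epsilon> *\<^sub>R (e 2 \<and>\<^sub>e e 3))"

text \<open>The fiber of \<open>\<And>\<^sup>2\<^sub>\<epsilon>E\<close> at \<^term>\<open>p\<close>, and its positively oriented orthonormal bases. Neither
  depends on the choice of \<^term>\<open>e\<close>.\<close>

definition half_fiber ::
    "(4, 'v::real_vector) vbundle \<Rightarrow> (torus \<Rightarrow> 'v \<Rightarrow> 'v \<Rightarrow> real) \<Rightarrow> real \<Rightarrow> torus \<Rightarrow> 'v ext2 set" where
  "half_fiber E h \<epsilon> p = {B. \<exists>e. positive_onb E h p e \<and> B \<in> span (range (Omega \<epsilon> e))}"

definition half_positive_onb ::
    "(4, 'v::real_vector) vbundle \<Rightarrow> (torus \<Rightarrow> 'v \<Rightarrow> 'v \<Rightarrow> real) \<Rightarrow>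
     (torus \<Rightarrow> 'v ext2 \<Rightarrow> 'v ext2 \<Rightarrow> real) \<Rightarrow> real \<Rightarrow> torus \<Rightarrow> (3 \<Rightarrow> 'v ext2) \<Rightarrow> bool" where
  "half_positive_onb E h hh \<epsilon> p \<omega> \<longleftrightarrow>
     (\<forall>i. \<omega> i \<in> half_fiber E h \<epsilon> p) \<and> orthonormal (hh p) \<omega> \<and>
     (\<exists>e. positive_onb E h p e \<and> same_orientation (Omega \<epsilon> e) \<omega>)"


section \<open>The topological holonomy group\<close>

definition SO3 :: "(real^3^3) monoid" where
  "SO3 = \<lparr> carrier = {A. orthogonal_matrix A \<and> det A = 1}, monoid.mult = (**), one = mat 1 \<rparr>"

lemma group_SO3: "group SO3"
proof (rule groupI)
  fix A assume "A \<in> carrier SO3"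
  then show "\<exists>B\<in>carrier SO3. B \<otimes>\<^bsub>SO3\<^esub> A = \<one>\<^bsub>SO3\<^esub>"
    by (intro bexI[of _ "transpose A"])
       (auto simp: SO3_def orthogonal_matrix_def det_transpose transpose_transpose)
qed (auto simp: SO3_def orthogonal_matrix_mul orthogonal_matrix_id det_mul matrix_mul_assoc)

text \<open>
  The holonomy matrix along an axis \<^term>\<open>c\<close>, as a set. Parallel sections are determined by their
  initial values and parallel transport preserves the metric and the orientation of \<open>\<And>\<^sup>2\<^sub>\<epsilon>E\<close>, so there
  is exactly one such matrix. Row vector times matrix:
  the \<^term>\<open>j\<close>-th entry of \<open>(\<Omega>\<^sub>1, \<Omega>\<^sub>2, \<Omega>\<^sub>3) C\<close> is \<open>\<Sum>\<^sub>i C\<^sub>i\<^sub>j \<Omega>\<^sub>i\<close>.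
\<close>
definition holonomy_matrix ::
    "(4, 'v::real_vector) vbundle \<Rightarrow> (torus \<Rightarrow> 'v \<Rightarrow> 'v \<Rightarrow> real) \<Rightarrow>
     (vfield \<Rightarrow> (torus \<Rightarrow> 'v ext2) \<Rightarrow> torus \<Rightarrow> 'v ext2) \<Rightarrow> real \<Rightarrow> (3 \<Rightarrow> 'v ext2) \<Rightarrow>
     (real \<Rightarrow> real \<times> real) \<Rightarrow> (real^3^3) set" where
  "holonomy_matrix E h DD \<epsilon> \<omega> c =
     {C \<in> carrier SO3. \<exists>\<Omega> :: 3 \<Rightarrow> real \<Rightarrow> 'v ext2.
        (\<forall>i. (\<forall>t. \<Omega> i t \<in> half_fiber E h \<epsilon> (pr (c t))) \<and>
           parallel_along (ext2_bundle E) DD c (\<Omega> i) \<and> \<Omega> i 0 = \<omega> i) \<and>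
        (\<forall>a j. \<Omega> j (a + 2 * pi) = (\<Sum>i\<in>UNIV. C $ i $ j *\<^sub>R \<Omega> i a))}"

definition topological_holonomy_group ::
    "(4, 'v::real_vector) vbundle \<Rightarrow> (torus \<Rightarrow> 'v \<Rightarrow> 'v \<Rightarrow> real) \<Rightarrow>
     (vfield \<Rightarrow> (torus \<Rightarrow> 'v ext2) \<Rightarrow> torus \<Rightarrow> 'v ext2) \<Rightarrow> real \<Rightarrow> (3 \<Rightarrow> 'v ext2) \<Rightarrow>
     (real^3^3) set" where
  "topological_holonomy_group E h DD \<epsilon> \<omega> =
     generate SO3 (holonomy_matrix E h DD \<epsilon> \<omega> (\<lambda>x. (x, 0)) \<union>
                   holonomy_matrix E h DD \<epsilon> \<omega> (\<lambda>y. (0, y)))"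

text \<open>\<^const>\<open>group.ord\<close> is \<open>0\<close> on elements of infinite order.\<close>
definition eord :: "real^3^3 \<Rightarrow> enat" where
  "eord A = (if group.ord SO3 A = 0 then \<infinity> else enat (group.ord SO3 A))"

end

theory Submission
  imports Defs
begin

text \<open>
  The holonomy matrices lie in \<open>SO(3)\<close> by definition, so the topological holonomy group \<open>G\<close> is
  a subgroup of \<open>SO(3)\<close>, and its density follows from a fact about such subgroups
  (\<open>dense_subgroup_SO3\<close>): the closure \<open>H\<close> of \<open>G\<close> in the space of matrices is
  again a group, and it has to be all of \<open>SO(3)\<close>.

  By Euler, \<open>C\<^sub>1\<close> is a rotation about some unit vector \<open>n\<close>. Infinite order means that its angle is
  an irrational multiple of \<open>2\<pi>\<close>, and by Kronecker's theorem the powers of \<open>C\<^sub>1\<close> are dense among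
  the rotations about \<open>n\<close> (\<open>rot_powers_dense\<close>). Thus \<open>H\<close> contains every rotation about \<open>n\<close>, that
  is, the stabiliser of \<open>n\<close> in \<open>SO(3)\<close>.

  The second element moves the axis of \<open>C\<^sub>1\<close>: if \<open>C\<^sub>2 n = n\<close>, then \<open>C\<^sub>1\<close> and \<open>C\<^sub>2\<close> are rotations
  about the same vector and commute; if \<open>C\<^sub>2 n = -n\<close>, then \<open>C\<^sub>2\<close> is a half-turn about a vector
  orthogonal to \<open>n\<close> and has order 2.

  It remains to see that \<open>H\<close> acts transitively on the sphere, since a transitive subgroup containing
  a point stabiliser is the whole group. As \<open>H\<close> contains the rotations about \<open>n\<close>, the orbit of \<open>n\<close>
  is determined by the set \<open>Z\<close> of the heights \<open>Bn \<bullet> n\<close>, \<open>B \<in> H\<close>. Rotating \<open>Bn\<close> about \<open>n\<close> and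
  moving back by the inverse of \<open>B\<close> shows that with a height \<open>z = cos \<beta>\<close>, where \<open>\<bar>z\<bar> < 1\<close>, the set
  \<open>Z\<close> contains the whole interval from \<open>2z\<^sup>2 - 1 = cos 2\<beta>\<close> to \<open>1\<close>. Doubling the angle repeatedly
  from \<open>z = C\<^sub>2 n \<bullet> n\<close> puts \<open>0\<close> into \<open>Z\<close>, and a last step gives \<open>Z = [-1, 1]\<close>
  (\<open>SO3_from_axis_rotations\<close>).
\<close>

section \<open>The group \<open>SO(3)\<close>\<close>

lemma SO3_iff: "A \<in> carrier SO3 \<longleftrightarrow> orthogonal_matrix A \<and> det A = 1"
  by (simp add: SO3_def)

lemma SO3_transpose: "A \<in> carrier SO3 \<Longrightarrow> transpose A \<in> carrier SO3"
  by (simp add: SO3_iff)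

lemma SO3_mult: "A \<in> carrier SO3 \<Longrightarrow> B \<in> carrier SO3 \<Longrightarrow> A ** B \<in> carrier SO3"
  by (simp add: SO3_iff orthogonal_matrix_mul det_mul)

lemma SO3_transpose_mult [simp]:
  assumes "A \<in> carrier SO3"
  shows "transpose A ** A = mat 1" "A ** transpose A = mat 1"
  using assms unfolding SO3_iff orthogonal_matrix_def by blast+

lemma SO3_inv: assumes "A \<in> carrier SO3" shows "inv\<^bsub>SO3\<^esub> A = transpose A"
  using assms SO3_transpose[OF assms] SO3_transpose_mult(1)[OF assms]
  by (intro group.inv_equality[OF group_SO3]) (simp_all add: SO3_def del: SO3_transpose_mult)

lemma SO3_square: "C [^]\<^bsub>SO3\<^esub> (2::nat) = C ** C" if "C \<in> carrier SO3"
  using that by (simp add: SO3_def numeral_2_eq_2)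

lemma inner_SO3: assumes "A \<in> carrier SO3" shows "(A *v u) \<bullet> (A *v v) = u \<bullet> v"
proof -
  have "(A *v u) \<bullet> (A *v v) = (transpose A *v (A *v u)) \<bullet> v"
    by (simp add: dot_lmul_matrix)
  then show ?thesis
    using assms by (simp add: matrix_vector_mul_assoc del: transpose_matrix_vector)
qed

lemma norm_SO3: assumes "A \<in> carrier SO3" shows "norm (A *v u) = norm u"
  using inner_SO3[OF assms, of u u] by (simp add: norm_eq_sqrt_inner)

text \<open>
  Euler's theorem: \<open>1\<close> is an eigenvalue, because \<open>A - 1 = A (1 - A)\<^sup>T\<close> gives
  \<open>det (A - 1) = det (1 - A)\<close>, while in dimension three the two determinants are opposite.
\<close>
lemma SO3_axis:
  assumes "A \<in> carrier SO3"
  obtains n where "norm n = 1" "A *v n = n"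
proof -
  have eq: "A - mat 1 = A ** transpose (mat 1 - A)"
  proof -
    have "transpose (mat 1 - A) = mat 1 - transpose A"
      by (simp add: transpose_def mat_def vec_eq_iff)
    moreover have "A ** (mat 1 - transpose A) = A ** mat 1 - A ** transpose A"
      by (simp add: matrix_matrix_mult_def vec_eq_iff right_diff_distrib sum_subtractf)
    ultimately show ?thesis
      using assms by simp
  qed
  have "det (A - mat 1) = det (mat 1 - A)"
    using assms unfolding eq by (simp add: det_mul SO3_iff)
  moreover have "det (mat 1 - A) = - det (A - mat 1)"
    by (simp add: det_3 mat_def algebra_simps)
  ultimately have "det (A - mat 1) = 0"
    by simp
  then obtain x where x: "(A - mat 1) *v x = 0" "x \<noteq> 0"
    by (metis invertible_det_nz invertible_left_inverse matrix_left_invertible_ker)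
  then have "A *v x = x"
    by (simp add: matrix_vector_mult_diff_rdistrib)
  then show ?thesis
    using x by (intro that[of "x /\<^sub>R norm x"]) (simp_all add: matrix_vector_mult_scaleR)
qed

section \<open>Rotations about the third coordinate vector\<close>

definition Rz :: "real \<Rightarrow> real^3^3" where
  "Rz t = vector [vector [cos t, - sin t, 0], vector [sin t, cos t, 0], vector [0, 0, 1]]"

lemma Rz_add: "Rz s ** Rz t = Rz (s + t)"
  by (simp add: Rz_def matrix_matrix_mult_def vec_eq_iff forall_3 sum_3 cos_add sin_add)

lemma Rz_0: "Rz 0 = mat 1"
  by (simp add: Rz_def mat_def vec_eq_iff forall_3)

lemma transpose_Rz: "transpose (Rz t) = Rz (- t)"
  by (simp add: Rz_def transpose_def vec_eq_iff forall_3)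

lemma Rz_SO3: "Rz t \<in> carrier SO3"
proof -
  have "det (Rz t) = 1"
    by (simp add: Rz_def det_3 flip: power2_eq_square)
  then show ?thesis
    by (simp add: SO3_iff orthogonal_matrix transpose_Rz Rz_add Rz_0 del: SO3_transpose_mult)
qed

lemma Rz_periodic: "Rz (t + 2 * pi * of_int k) = Rz t"
  by (simp add: Rz_def cos_add sin_add)

lemma continuous_on_Rz: "continuous_on UNIV Rz"
proof -
  have eq: "Rz = (\<lambda>t. cos t *\<^sub>R vector [vector [1, 0, 0], vector [0, 1, 0], vector [0, 0, 0]] +
      sin t *\<^sub>R vector [vector [0, -1, 0], vector [1, 0, 0], vector [0, 0, 0]] +
      vector [vector [0, 0, 0], vector [0, 0, 0], vector [0, 0, 1]])"
    by (simp add: fun_eq_iff Rz_def vec_eq_iff forall_3)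
  show ?thesis
    unfolding eq by (intro continuous_intros)
qed

text \<open>
  With the third column also the third row of \<open>A\<close> is that of the identity, and the remaining
  block is a plane rotation: its entries satisfy \<open>(a - d)\<^sup>2 + (b + c)\<^sup>2 = 0\<close>.
\<close>
lemma SO3_fixing_e3:
  assumes A: "A \<in> carrier SO3" and e: "A *v axis 3 1 = axis 3 1"
  obtains t where "A = Rz t"
proof -
  have c: "A$1$3 = 0" "A$2$3 = 0" "A$3$3 = 1"
    using arg_cong[OF e, of "\<lambda>v. v $ 1"] arg_cong[OF e, of "\<lambda>v. v $ 2"] arg_cong[OF e, of "\<lambda>v. v $ 3"]
    unfolding matrix_vector_mult_basis by (simp_all add: column_def axis_def)
  have "transpose A *v axis 3 1 = transpose A *v (A *v axis 3 1)"
    by (simp only: e)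
  then have e': "transpose A *v axis 3 1 = axis 3 1"
    using A by (simp add: matrix_vector_mul_assoc)
  have r: "A$3$1 = 0" "A$3$2 = 0"
    using arg_cong[OF e', of "\<lambda>v. v $ 1"] arg_cong[OF e', of "\<lambda>v. v $ 2"]
    unfolding matrix_vector_mult_basis by (simp_all add: column_def transpose_def axis_def)
  have "A ** transpose A = mat 1" "det A = 1"
    using A SO3_iff by auto
  then have *: "A$1$1 * A$1$1 + A$1$2 * A$1$2 = 1" "A$1$1 * A$2$1 + A$1$2 * A$2$2 = 0"
      "A$2$1 * A$2$1 + A$2$2 * A$2$2 = 1" "A$1$1 * A$2$2 - A$1$2 * A$2$1 = 1"
    by (simp_all add: det_3 r c vec_eq_iff forall_3 matrix_matrix_mult_def transpose_def mat_def sum_3)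
  then have "(A$1$1 - A$2$2)\<^sup>2 + (A$1$2 + A$2$1)\<^sup>2 = 0"
    by (simp add: power2_eq_square algebra_simps)
  then have "A$2$2 = A$1$1" "A$1$2 = - A$2$1"
    by (simp_all add: sum_power2_eq_zero_iff)
  moreover from this obtain t where "A$1$1 = cos t" "A$2$1 = sin t"
    using * sincos_total_2pi[of "A$1$1" "A$2$1"] by (auto simp: power2_eq_square)
  ultimately have "A = Rz t"
    by (simp add: r c Rz_def vec_eq_iff forall_3)
  then show ?thesis by (rule that)
qed

text \<open>
  Here the upper left block is orthogonal with determinant \<open>-1\<close>, that is, a reflection, so that
  \<open>A\<close> is symmetric and hence its own inverse.
\<close>
lemma SO3_negating_e3:
  assumes A: "A \<in> carrier SO3" and e: "A *v axis 3 1 = - axis 3 1"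
  shows "A ** A = mat 1"
proof -
  have c: "A$1$3 = 0" "A$2$3 = 0" "A$3$3 = -1"
    using arg_cong[OF e, of "\<lambda>v. v $ 1"] arg_cong[OF e, of "\<lambda>v. v $ 2"] arg_cong[OF e, of "\<lambda>v. v $ 3"]
    unfolding matrix_vector_mult_basis by (simp_all add: column_def axis_def)
  have "transpose A *v axis 3 1 = - (transpose A *v (A *v axis 3 1))"
    using linear_neg[OF matrix_vector_mul_linear[of "transpose A"], of "axis 3 1"] unfolding e
    by (simp del: transpose_matrix_vector)
  then have e': "transpose A *v axis 3 1 = - axis 3 1"
    using A by (simp add: matrix_vector_mul_assoc del: transpose_matrix_vector)
  have r: "A$3$1 = 0" "A$3$2 = 0"
    using arg_cong[OF e', of "\<lambda>v. v $ 1"] arg_cong[OF e', of "\<lambda>v. v $ 2"]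
    unfolding matrix_vector_mult_basis by (simp_all add: column_def transpose_def axis_def)
  have "A ** transpose A = mat 1" "det A = 1"
    using A SO3_iff by auto
  then have *: "A$1$1 * A$1$1 + A$1$2 * A$1$2 = 1" "A$1$1 * A$2$1 + A$1$2 * A$2$2 = 0"
      "A$2$1 * A$2$1 + A$2$2 * A$2$2 = 1" "A$1$1 * A$2$2 - A$1$2 * A$2$1 = -1"
    by (simp_all add: det_3 r c vec_eq_iff forall_3 matrix_matrix_mult_def transpose_def mat_def sum_3)
  then have "(A$1$1 + A$2$2)\<^sup>2 + (A$1$2 - A$2$1)\<^sup>2 = 0"
    by (simp add: power2_eq_square algebra_simps)
  then have "A$2$2 = - A$1$1" "A$1$2 = A$2$1"
    by (simp_all add: sum_power2_eq_zero_iff)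
  then have "transpose A = A"
    by (simp add: r c transpose_def vec_eq_iff forall_3)
  then show ?thesis
    using \<open>A ** transpose A = mat 1\<close> by simp
qed

lemma Rz_transitive:
  assumes n: "norm u = norm v" and 3: "u $ 3 = v $ 3"
  obtains t where "Rz t *v u = v"
proof -
  define r where "r = u$1 * u$1 + u$2 * u$2"
  have r': "v$1 * v$1 + v$2 * v$2 = r"
    using n 3 unfolding norm_eq by (simp add: r_def inner_vec_def sum_3)
  show ?thesis
  proof (cases "r = 0")
    case True
    then have "u = v"
      using r' 3 unfolding r_def vec_eq_iff forall_3
      by (metis sum_squares_eq_zero_iff)
    then show ?thesis
      by (intro that[of 0]) (simp add: Rz_0)
  next
    case False
    \<comment> \<open>Cosine and sine of the angle from \<open>(u\<^sub>1, u\<^sub>2)\<close> to \<open>(v\<^sub>1, v\<^sub>2)\<close>.\<close>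
    define c s where "c = (u$1 * v$1 + u$2 * v$2) / r" and "s = (u$1 * v$2 - u$2 * v$1) / r"
    have cs: "c * r = u$1 * v$1 + u$2 * v$2" "s * r = u$1 * v$2 - u$2 * v$1"
      using False by (simp_all add: c_def s_def)
    have "(c\<^sup>2 + s\<^sup>2) * r\<^sup>2 = (u$1 * v$1 + u$2 * v$2)\<^sup>2 + (u$1 * v$2 - u$2 * v$1)\<^sup>2"
      unfolding cs[symmetric] by (simp add: power_mult_distrib distrib_right)
    also have "\<dots> = (u$1 * u$1 + u$2 * u$2) * (v$1 * v$1 + v$2 * v$2)"
      by (simp add: power2_eq_square algebra_simps)
    also have "\<dots> = r\<^sup>2"
      unfolding r' r_def[symmetric] by (simp add: power2_eq_square)
    finally have "c\<^sup>2 + s\<^sup>2 = 1"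
      using False by (simp add: power2_eq_square)
    then obtain t where t: "c = cos t" "s = sin t"
      using sincos_total_2pi[of c s] by blast
    have "(c * u$1 - s * u$2) * r = (c * r) * u$1 - (s * r) * u$2"
        "(s * u$1 + c * u$2) * r = (s * r) * u$1 + (c * r) * u$2"
      by (simp_all add: algebra_simps)
    then have "(c * u$1 - s * u$2) * r = v$1 * r" "(s * u$1 + c * u$2) * r = v$2 * r"
      unfolding cs by (simp_all add: r_def algebra_simps)
    then have "c * u$1 - s * u$2 = v$1" "s * u$1 + c * u$2 = v$2"
      using False by auto
    then show ?thesis
      using 3 by (intro that[of t]) (simp add: t Rz_def matrix_vector_mult_def vec_eq_iff forall_3 sum_3)
  qed
qed

section \<open>Rotations about an arbitrary vector\<close>

text \<open>
  Rotations about an arbitrary vector are conjugates of rotations about the third coordinate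
  vector; this provides the conjugating matrix.
\<close>
lemma SO3_frame:
  fixes n :: "real^3"
  assumes "norm n = 1"
  obtains P where "P \<in> carrier SO3" "P *v axis 3 1 = n"
proof -
  obtain f :: "real^3 \<Rightarrow> real^3"
    where f: "orthogonal_transformation f" "det (matrix f) = 1" "f (axis 3 1) = n"
    using rotation_exists_1[of "axis 3 1 :: real^3" n] assms by (auto simp: norm_axis_1)
  then have "matrix f \<in> carrier SO3"
    by (auto simp: SO3_iff orthogonal_transformation_matrix)
  moreover have "matrix f *v axis 3 1 = n"
    using f by (simp add: matrix_works orthogonal_transformation_linear matrix_vector_mul(2)[symmetric])
  ultimately show ?thesis by (rule that)
qed

lemma SO3_conjugation:
  assumes "P \<in> carrier SO3"
  shows "P ** (transpose P ** A ** P) ** transpose P = A"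
    "(P ** A ** transpose P) ** (P ** B ** transpose P) = P ** (A ** B) ** transpose P"
    "(transpose P ** A ** P) ** (transpose P ** B ** P) = transpose P ** (A ** B) ** P"
proof -
  note eqs = SO3_transpose_mult[OF assms]
  have l: "transpose P ** (P ** X) = X" "P ** (transpose P ** X) = X" for X
    by (simp_all add: matrix_mul_assoc eqs)
  show "P ** (transpose P ** A ** P) ** transpose P = A"
    "(P ** A ** transpose P) ** (P ** B ** transpose P) = P ** (A ** B) ** transpose P"
    "(transpose P ** A ** P) ** (transpose P ** B ** P) = transpose P ** (A ** B) ** P"
    by (simp_all add: eqs l flip: matrix_mul_assoc)
qed

text \<open>
  The rotation through the angle \<open>t\<close> about the unit vector \<open>P *v axis 3 1\<close>, the image under
  \<open>P\<close> of the third coordinate vector. It is parametrised by \<open>P\<close> because a vector alone does not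
  single out a conjugating matrix.
\<close>
definition rot :: "real^3^3 \<Rightarrow> real \<Rightarrow> real^3^3" where
  "rot P t = P ** Rz t ** transpose P"

lemma rot_add: "P \<in> carrier SO3 \<Longrightarrow> rot P s ** rot P t = rot P (s + t)"
  by (simp add: rot_def SO3_conjugation Rz_add)

lemma rot_0: "P \<in> carrier SO3 \<Longrightarrow> rot P 0 = mat 1"
  by (simp add: rot_def Rz_0)

lemma rot_periodic: "rot P (t + 2 * pi * of_int k) = rot P t"
  by (simp add: rot_def Rz_periodic)

lemma SO3_fixing_axis:
  assumes "P \<in> carrier SO3" "A \<in> carrier SO3" "A *v (P *v axis 3 1) = P *v axis 3 1"
  obtains t where "A = rot P t"
proof -
  have "(transpose P ** A ** P) *v axis 3 1 = transpose P *v (A *v (P *v axis 3 1))"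
    by (simp add: matrix_vector_mul_assoc matrix_mul_assoc del: transpose_matrix_vector)
  also have "\<dots> = axis 3 1"
    unfolding assms(3) using assms(1) by (simp add: matrix_vector_mul_assoc del: transpose_matrix_vector)
  finally obtain t where "transpose P ** A ** P = Rz t"
    using SO3_fixing_e3 assms by (metis SO3_mult SO3_transpose)
  then have "A = rot P t"
    using SO3_conjugation(1)[OF assms(1), of A] by (simp add: rot_def)
  then show ?thesis by (rule that)
qed

lemma SO3_negating_axis:
  assumes "P \<in> carrier SO3" "A \<in> carrier SO3" "A *v (P *v axis 3 1) = - (P *v axis 3 1)"
  shows "A ** A = mat 1"
proof -
  have neg: "transpose P *v (- (P *v axis 3 1)) = - (transpose P *v (P *v axis 3 1))"
    using linear_neg[OF matrix_vector_mul_linear[of "transpose P"]] .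
  have "(transpose P ** A ** P) *v axis 3 1 = transpose P *v (A *v (P *v axis 3 1))"
    by (simp add: matrix_vector_mul_assoc matrix_mul_assoc del: transpose_matrix_vector)
  also have "\<dots> = - axis 3 1"
    unfolding assms(3) neg using assms(1) by (simp add: matrix_vector_mul_assoc del: transpose_matrix_vector)
  finally have "(transpose P ** A ** P) ** (transpose P ** A ** P) = mat 1"
    using assms by (intro SO3_negating_e3 SO3_mult SO3_transpose)
  then have "transpose P ** (A ** A) ** P = mat 1"
    by (simp only: SO3_conjugation(3)[OF assms(1)])
  then have "A ** A = P ** mat 1 ** transpose P"
    using SO3_conjugation(1)[OF assms(1), of "A ** A"] by simp
  then show ?thesis
    using assms(1) by simp
qed

lemma inner_transpose: "(transpose A *v u) \<bullet> v = u \<bullet> (A *v v)" for A :: "real^'n^'m"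
  by (simp add: dot_lmul_matrix)

text \<open>
  Two points of a sphere at the same height above the plane orthogonal to the axis lie on a
  common circle about the axis.
\<close>
lemma rot_transitive:
  assumes P: "P \<in> carrier SO3" and n: "norm u = norm v"
    and 3: "u \<bullet> (P *v axis 3 1) = v \<bullet> (P *v axis 3 1)"
  obtains t where "rot P t *v u = v"
proof -
  have c: "(transpose P *v u) $ 3 = u \<bullet> (P *v axis 3 1)" for u
    by (simp add: inner_axis flip: inner_transpose del: transpose_matrix_vector)
  obtain t where "Rz t *v (transpose P *v u) = transpose P *v v"
    using Rz_transitive[of "transpose P *v u" "transpose P *v v"] P n 3 
    by (auto simp: c norm_SO3 SO3_transpose simp del: transpose_matrix_vector)
  then have "P *v (Rz t *v (transpose P *v u)) = P *v (transpose P *v v)"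
    by simp
  then have "rot P t *v u = v"
    using P by (simp add: rot_def matrix_vector_mul_assoc matrix_mul_assoc del: transpose_matrix_vector)
  then show ?thesis by (rule that)
qed

text \<open>
  If \<open>x\<close> makes the angle \<open>\<beta>\<close> with the axis, then the angle between \<open>x\<close> and its rotated copies
  takes all values from \<open>0\<close> to \<open>2\<beta>\<close>, the latter under the half-turn (with \<open>2\<beta>\<close> replaced by
  \<open>2\<pi> - 2\<beta>\<close> if \<open>\<beta>\<close> is obtuse); here \<open>z = cos \<beta>\<close> and \<open>2z\<^sup>2 - 1 = cos 2\<beta>\<close>.
\<close>
lemma rot_inner_range:
  assumes P: "P \<in> carrier SO3" and x: "norm x = 1" and z: "x \<bullet> (P *v axis 3 1) = z" "\<bar>z\<bar> < 1"
    and w: "2 * z\<^sup>2 - 1 \<le> w" "w \<le> 1"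
  obtains t where "(rot P t *v x) \<bullet> x = w"
proof -
  define y where "y = transpose P *v x"
  have y3: "y $ 3 = z"
    unfolding y_def z(1)[symmetric] inner_transpose[symmetric] by (simp add: inner_axis)
  have "norm y = 1"
    using P x unfolding y_def by (simp add: norm_SO3 SO3_transpose del: transpose_matrix_vector)
  then have y: "y$1 * y$1 + y$2 * y$2 = 1 - z\<^sup>2"
    using y3 by (simp add: norm_eq_1 inner_vec_def sum_3 power2_eq_square)
  have inner: "(rot P t *v x) \<bullet> x = cos t * (1 - z\<^sup>2) + z\<^sup>2" for t
  proof -
    have "(rot P t *v x) \<bullet> x = (P *v (Rz t *v y)) \<bullet> (P *v y)"
      using P by (simp add: rot_def y_def matrix_vector_mul_assoc matrix_mul_assoc del: transpose_matrix_vector)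
    also have "\<dots> = cos t * (y$1 * y$1 + y$2 * y$2) + y$3 * y$3"
      unfolding inner_SO3[OF P] by (simp add: Rz_def matrix_vector_mult_def inner_vec_def sum_3 algebra_simps)
    finally show ?thesis
      by (simp add: y y3 power2_eq_square)
  qed
  have "z\<^sup>2 < 1"
    using z(2) by (simp add: abs_square_less_1)
  then have "-1 \<le> (w - z\<^sup>2) / (1 - z\<^sup>2)" "(w - z\<^sup>2) / (1 - z\<^sup>2) \<le> 1"
    using w by (simp_all add: field_simps)
  then have "(rot P (arccos ((w - z\<^sup>2) / (1 - z\<^sup>2))) *v x) \<bullet> x = w"
    using \<open>z\<^sup>2 < 1\<close> by (simp add: inner)
  then show ?thesis by (rule that)
qed

section \<open>A group containing all rotations about one axis\<close>

text \<open>
  Such a group is \<open>SO(3)\<close> as soon as one of its elements moves the axis. The set \<open>Z\<close> collects the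
  heights above the plane orthogonal to \<open>n\<close> of the points in the orbit of \<open>n\<close>; the proof shows
  \<open>Z = [-1, 1]\<close>, that is, transitivity on the unit sphere.
\<close>
lemma SO3_from_axis_rotations:
  assumes H: "H \<subseteq> carrier SO3" and 1: "mat 1 \<in> H"
    and mult: "\<And>A B. A \<in> H \<Longrightarrow> B \<in> H \<Longrightarrow> A ** B \<in> H"
    and transp: "\<And>A. A \<in> H \<Longrightarrow> transpose A \<in> H"
    and P: "P \<in> carrier SO3" and rot: "\<And>t. rot P t \<in> H"
    and C: "C \<in> H" "C *v (P *v axis 3 1) \<noteq> P *v axis 3 1" "C *v (P *v axis 3 1) \<noteq> - (P *v axis 3 1)"
  shows "H = carrier SO3"
proof
  define n :: "real^3" where "n = P *v axis 3 1"
  have n: "norm n = 1"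
    using P by (simp add: n_def norm_SO3 norm_axis_1)
  have Bn: "norm (B *v n) = 1" if "B \<in> carrier SO3" for B
    using that n by (simp add: norm_SO3)
  define Z where "Z = {(B *v n) \<bullet> n |B. B \<in> H}"
  have step: "w \<in> Z" if z: "z \<in> Z" "\<bar>z\<bar> < 1" and w: "2 * z\<^sup>2 - 1 \<le> w" "w \<le> 1" for z w
  proof -
    obtain B where B: "B \<in> H" "(B *v n) \<bullet> n = z"
      using \<open>z \<in> Z\<close> by (auto simp: Z_def)
    obtain t where t: "(rot P t *v (B *v n)) \<bullet> (B *v n) = w"
      using rot_inner_range[OF P, of "B *v n" z w] B H Bn z w by (auto simp: n_def)
    \<comment> \<open>The rotation \<open>rot P t\<close> fixes \<open>n\<close> but moves \<open>B n\<close>; the height of this element is the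
      inner product of \<open>rot P t (B n)\<close> with \<open>B n\<close>.\<close>
    have "transpose B ** rot P t ** B \<in> H"
      by (intro mult transp B rot)
    moreover have "((transpose B ** rot P t ** B) *v n) \<bullet> n = w"
      unfolding t[symmetric] inner_transpose[symmetric]
      by (simp add: matrix_vector_mul_assoc matrix_mul_assoc del: transpose_matrix_vector)
    ultimately show ?thesis
      unfolding Z_def by blast
  qed
  have bound: "\<bar>(B *v n) \<bullet> n\<bar> \<le> 1" if "B \<in> carrier SO3" for B
    using Cauchy_Schwarz_ineq2[of "B *v n" n] Bn[OF that] n by simp
  define c where "c = (C *v n) \<bullet> n"
  have nn: "n \<bullet> n = 1" "(C *v n) \<bullet> (C *v n) = 1"
    using n Bn[of C] C(1) H by (auto simp: norm_eq_1)
  have "c \<noteq> 1"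
  proof
    assume "c = 1"
    then have "(C *v n - n) \<bullet> (C *v n - n) = 0"
      using nn by (simp add: inner_diff inner_commute c_def)
    then show False
      using C(2) by (simp add: n_def)
  qed
  moreover have "c \<noteq> -1"
  proof
    assume "c = -1"
    then have "(C *v n + n) \<bullet> (C *v n + n) = 0"
      using nn by (simp add: inner_add inner_commute c_def)
    then show False
      using C(3) by (simp add: n_def add_eq_0_iff2)
  qed
  moreover have "\<bar>c\<bar> \<le> 1"
    using bound C(1) H by (auto simp: c_def)
  ultimately have c: "\<bar>c\<bar> < 1"
    by linarith
  have cZ: "c \<in> Z"
    using C(1) by (auto simp: Z_def c_def)
  have "0 \<in> Z"
  proof (rule ccontr)
    assume 0: "0 \<notin> Z"
    \<comment> \<open>Without the height \<open>0\<close>, angle doubling never leaves the upper hemisphere, while for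
      \<open>0 < z < 1\<close> the defect \<open>1 - (2z\<^sup>2 - 1) = 2 (1 - z) (1 + z)\<close> is more than twice the defect
      \<open>1 - z\<close>.\<close>
    define \<delta> where "\<delta> = 2 * (1 - c\<^sup>2)"
    have c2: "c\<^sup>2 < 1"
      using c by (simp add: abs_square_less_1)
    have pos: "0 < 2 * z\<^sup>2 - 1" if "z \<in> Z" "\<bar>z\<bar> < 1" for z
      using step[OF that, of 0] 0 by force
    have "\<exists>z\<in>Z. 0 < z \<and> z < 1 \<and> 2 ^ k * \<delta> \<le> 1 - z" for k
    proof (induction k)
      case 0
      then show ?case
        using pos[OF cZ c] step[OF cZ c, of "2 * c\<^sup>2 - 1"] c2
        by (intro bexI[of _ "2 * c\<^sup>2 - 1"]) (auto simp: \<delta>_def)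
    next
      case (Suc k)
      then obtain z where z: "z \<in> Z" "0 < z" "z < 1" "2 ^ k * \<delta> \<le> 1 - z"
        by blast
      have z2: "z\<^sup>2 < z"
        using z(2,3) by (simp add: power2_eq_square)
      show ?case
        using pos[OF z(1)] step[OF z(1), of "2 * z\<^sup>2 - 1"] z z2
        by (intro bexI[of _ "2 * z\<^sup>2 - 1"]) auto
    qed
    then have "2 ^ k * \<delta> < 1" for k
      by (smt (verit))
    moreover obtain k where "1 / \<delta> < 2 ^ k"
      using real_arch_pow[of 2 "1 / \<delta>"] by auto
    moreover have "\<delta> > 0"
      using c2 by (simp add: \<delta>_def)
    ultimately show False
      by (simp add: field_simps) (meson less_asym)
  qed
  then have Z: "w \<in> Z" if "\<bar>w\<bar> \<le> 1" for w
    using step[of 0 w] that by auto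
  show "carrier SO3 \<subseteq> H"
  proof
    fix A assume A: "A \<in> carrier SO3"
    obtain B where B: "B \<in> H" "(B *v n) \<bullet> n = (A *v n) \<bullet> n"
      using Z[OF bound[OF A]] by (auto simp: Z_def)
    obtain t where t: "rot P t *v (B *v n) = A *v n"
      using rot_transitive[OF P, of "B *v n" "A *v n"] B Bn A H by (auto simp: n_def)
    define R where "R = rot P t ** B"
    have R: "R \<in> H" "R *v n = A *v n"
      using t B(1) mult rot by (auto simp: R_def matrix_vector_mul_assoc)
    then have R': "R \<in> carrier SO3"
      using H by auto
    \<comment> \<open>\<open>R \<in> H\<close> has the same effect on \<open>n\<close> as \<open>A\<close>, so the two differ by a rotation about
      \<open>n\<close>, which lies in \<open>H\<close> as well.\<close>
    have "(transpose R ** A) *v n = transpose R *v (R *v n)"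
      by (simp add: R matrix_vector_mul_assoc del: transpose_matrix_vector)
    also have "\<dots> = n"
      using R' by (simp add: matrix_vector_mul_assoc del: transpose_matrix_vector)
    finally obtain s where "transpose R ** A = rot P s"
      using SO3_fixing_axis[OF P, of "transpose R ** A"] A R' by (auto simp: n_def SO3_mult SO3_transpose)
    then have "A = R ** rot P s"
      using R' by (metis SO3_transpose_mult(2) matrix_mul_assoc matrix_mul_lid)
    then show "A \<in> H"
      using mult R(1) rot by simp
  qed
qed (rule H)


section \<open>Closures of matrix groups\<close>

lemma continuous_on_matrix_mult:
  fixes f :: "'a::topological_space \<Rightarrow> real^'n^'m" and g :: "'a \<Rightarrow> real^'k^'n"
  assumes "continuous_on S f" "continuous_on S g"
  shows "continuous_on S (\<lambda>x. f x ** g x)"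
  unfolding matrix_matrix_mult_def by (intro continuous_intros assms)

lemma continuous_on_transpose:
  fixes f :: "'a::topological_space \<Rightarrow> real^'n^'m"
  assumes "continuous_on S f"
  shows "continuous_on S (\<lambda>x. transpose (f x))"
  unfolding transpose_def by (intro continuous_intros assms)

lemma closed_SO3: "closed (carrier SO3)"
proof -
  have "carrier SO3 = {A. transpose A ** A = mat 1 \<and> det A = 1}"
    by (auto simp: SO3_iff orthogonal_matrix)
  also have "closed \<dots>"
    unfolding det_3
    by (intro closed_Collect_conj closed_Collect_eq continuous_on_matrix_mult continuous_on_transpose
      continuous_intros)
  finally show ?thesis .
qed

text \<open>
  Continuity in one factor at a time is enough: the set of admissible right factors is closed,
  and then so is the set of admissible left factors.
\<close>
lemma closure_mult:
  assumes G: "\<And>A B. A \<in> G \<Longrightarrow> B \<in> G \<Longrightarrow> A ** B \<in> G" and A: "A \<in> closure G" and B: "B \<in> closure G"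
  shows "A ** B \<in> closure (G :: (real^'n^'n) set)"
proof -
  have left: "A' ** B \<in> closure G" if "A' \<in> G" for A'
  proof -
    have "closed ((\<lambda>X. A' ** X) -` closure G)"
      by (intro closed_vimage continuous_on_matrix_mult continuous_intros closed_closure)
    moreover have "G \<subseteq> (\<lambda>X. A' ** X) -` closure G"
      using G that closure_subset by blast
    ultimately show ?thesis
      using B closure_minimal by blast
  qed
  have "closed ((\<lambda>X. X ** B) -` closure G)"
    by (intro closed_vimage continuous_on_matrix_mult continuous_intros closed_closure)
  moreover have "G \<subseteq> (\<lambda>X. X ** B) -` closure G"
    using left by blast
  ultimately show ?thesis
    using A closure_minimal by blast
qed

lemma closure_transpose:
  assumes G: "\<And>A. A \<in> G \<Longrightarrow> transpose A \<in> G" and A: "A \<in> closure G"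
  shows "transpose A \<in> closure (G :: (real^'n^'n) set)"
proof -
  have "closed (transpose -` closure G)"
    by (intro closed_vimage continuous_on_transpose continuous_intros closed_closure)
  moreover have "G \<subseteq> transpose -` closure G"
    using G closure_subset by blast
  ultimately show ?thesis
    using A closure_minimal by blast
qed

section \<open>Powers of a rotation of infinite order\<close>

lemma rot_pow:
  assumes "P \<in> carrier SO3"
  shows "rot P t [^]\<^bsub>SO3\<^esub> k = rot P (real k * t)"
proof (induction k)
  case 0
  then show ?case using assms by (simp add: rot_0 SO3_def)
next
  case (Suc k)
  have "rot P t [^]\<^bsub>SO3\<^esub> Suc k = rot P t [^]\<^bsub>SO3\<^esub> k ** rot P t"
    by (simp add: SO3_def)
  then show ?case
    using assms by (simp add: Suc rot_add algebra_simps)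
qed

text \<open>
  Infinite order makes \<open>\<theta> / 2\<pi>\<close> irrational, so by Kronecker's theorem the numbers
  \<open>k \<theta> - 2\<pi> h\<close> are dense in the real line; the angles whose rotation lies in the closure of the
  powers form a closed set containing them.
\<close>
lemma rot_powers_dense:
  assumes P: "P \<in> carrier SO3" and inf: "\<And>k::nat. k > 0 \<Longrightarrow> rot P \<theta> [^]\<^bsub>SO3\<^esub> k \<noteq> mat 1"
  shows "rot P t \<in> closure (range (\<lambda>k::nat. rot P \<theta> [^]\<^bsub>SO3\<^esub> k))" (is "_ \<in> closure ?G")
proof -
  have irr: "\<theta> / (2 * pi) \<notin> \<rat>"
  proof
    assume "\<theta> / (2 * pi) \<in> \<rat>"
    then obtain a b where ab: "\<theta> / (2 * pi) = of_int a / of_int b" "b > 0"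
      by (meson Rats_cases')
    then have "real (nat b) * \<theta> = 0 + 2 * pi * of_int a"
      by (simp add: field_simps)
    then have "rot P \<theta> [^]\<^bsub>SO3\<^esub> nat b = mat 1"
      using P by (simp only: rot_pow rot_periodic rot_0)
    then show False
      using inf[of "nat b"] ab by simp
  qed
  define T where "T = rot P -` closure ?G"
  have "closed T"
    unfolding T_def rot_def
    by (intro closed_vimage continuous_on_matrix_mult continuous_intros continuous_on_Rz closed_closure)
  moreover have "t \<in> closure T"
    unfolding closure_approachable
  proof (intro allI impI)
    fix e :: real assume "e > 0"
    then obtain h :: int and k :: int where hk: "k > 0"
        "\<bar>of_int k * (\<theta> / (2 * pi)) - of_int h - t / (2 * pi)\<bar> < e / (2 * pi)"
      using sequence_of_fractional_parts_is_dense[OF irr, of "e / (2 * pi)" "t / (2 * pi)"]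
      by (metis divide_pos_pos mult_pos_pos pi_gt_zero zero_less_numeral)
    define s where "s = real (nat k) * \<theta> + 2 * pi * of_int (- h)"
    have "rot P s = rot P \<theta> [^]\<^bsub>SO3\<^esub> nat k"
      using P unfolding s_def rot_periodic by (simp add: rot_pow)
    then have "s \<in> T"
      using closure_subset[of ?G] by (auto simp: T_def)
    moreover have "of_int k * (\<theta> / (2 * pi)) - of_int h - t / (2 * pi) = (s - t) / (2 * pi)"
      using hk(1) by (simp add: s_def field_simps)
    then have "\<bar>(s - t) / (2 * pi)\<bar> < e / (2 * pi)"
      using hk(2) by (simp only:)
    then have "dist s t < e"
      by (simp add: dist_real_def divide_less_cancel)
    ultimately show "\<exists>s\<in>T. dist s t < e" by blast
  qed
  ultimately show ?thesis
    by (simp add: T_def)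
qed

section \<open>Dense subgroups of \<open>SO(3)\<close>\<close>

text \<open>
  The assumption \<open>B ** B \<noteq> mat 1\<close> excludes half-turns: together with \<open>A\<close>, a half-turn that
  reverses the axis of \<open>A\<close> generates a group whose closure is only a copy of \<open>O(2)\<close>.
\<close>
theorem dense_subgroup_SO3:
  assumes G: "subgroup G SO3"
    and A: "A \<in> G" "group.ord SO3 A = 0"
    and B: "B \<in> G" "B ** B \<noteq> mat 1" and AB: "A ** B \<noteq> B ** A"
  shows "closure G = carrier SO3"
proof -
  interpret SO3: group SO3 by (rule group_SO3)
  have sub: "G \<subseteq> carrier SO3"
    using G by (rule subgroup.subset)
  have mult: "X ** Y \<in> G" if "X \<in> G" "Y \<in> G" for X Y
    using subgroup.m_closed[OF G that] by (simp add: SO3_def)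
  have transp: "transpose X \<in> G" if "X \<in> G" for X
    using subgroup.m_inv_closed[OF G that] sub that by (metis SO3_inv subsetD)
  have one: "mat 1 \<in> G"
    using subgroup.one_closed[OF G] by (simp add: SO3_def)
  have AC: "A \<in> carrier SO3" and BC: "B \<in> carrier SO3"
    using A(1) B(1) sub by auto
  obtain n where n: "norm n = 1" "A *v n = n"
    using SO3_axis[OF AC] .
  obtain P where P: "P \<in> carrier SO3" "P *v axis 3 1 = n"
    using SO3_frame[OF n(1)] .
  obtain \<theta> where \<theta>: "A = rot P \<theta>"
    using SO3_fixing_axis[OF P(1) AC] n P by auto
  have "rot P \<theta> [^]\<^bsub>SO3\<^esub> k \<noteq> mat 1" if "k > 0" for k :: nat
    using SO3.ord_eq_0[OF AC] A(2) that by (auto simp: \<theta> SO3_def)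
  then have "rot P t \<in> closure (range (\<lambda>k::nat. A [^]\<^bsub>SO3\<^esub> k))" for t
    unfolding \<theta> by (rule rot_powers_dense[OF P(1)])
  moreover have "A [^]\<^bsub>SO3\<^esub> k \<in> G" for k :: nat
    by (induction k) (use one mult A(1) in \<open>auto simp: SO3_def\<close>)
  ultimately have rot: "rot P t \<in> closure G" for t
    using closure_mono[of "range (\<lambda>k::nat. A [^]\<^bsub>SO3\<^esub> k)" G] by blast
  show ?thesis
  proof (rule SO3_from_axis_rotations[OF _ _ _ _ P(1) rot])
    show "closure G \<subseteq> carrier SO3"
      by (rule closure_minimal[OF sub closed_SO3])
    show "mat 1 \<in> closure G" "B \<in> closure G"
      using one B(1) closure_subset by blast+
    show "X ** Y \<in> closure G" if "X \<in> closure G" "Y \<in> closure G" for X Y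
      using closure_mult[OF mult that] .
    show "transpose X \<in> closure G" if "X \<in> closure G" for X
      using closure_transpose[OF transp that] .
    show "B *v (P *v axis 3 1) \<noteq> P *v axis 3 1"
    proof
      assume "B *v (P *v axis 3 1) = P *v axis 3 1"
      then obtain t where "B = rot P t"
        using SO3_fixing_axis[OF P(1) BC] by auto
      then show False
        using AB P(1) by (simp add: \<theta> rot_add add.commute)
    qed
    show "B *v (P *v axis 3 1) \<noteq> - (P *v axis 3 1)"
      using SO3_negating_axis[OF P(1) BC] B(2) by blast
  qed
qed

section \<open>The topological holonomy group\<close>

lemma eord_ge_3_imp_square_neq_1:
  assumes A: "A \<in> carrier SO3" and 3: "eord A \<ge> 3"
  shows "A ** A \<noteq> mat 1"
proof
  interpret SO3: group SO3 by (rule group_SO3)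
  assume "A ** A = mat 1"
  then have "A [^]\<^bsub>SO3\<^esub> (2::nat) = \<one>\<^bsub>SO3\<^esub>"
    using SO3_square[OF A] by (simp add: SO3_def)
  then have "SO3.ord A dvd 2"
    using SO3.pow_eq_id[OF A] by blast
  then have "SO3.ord A \<le> 2" "SO3.ord A \<noteq> 0"
    by (simp add: dvd_imp_le) (metis \<open>SO3.ord A dvd 2\<close> dvd_0_left_iff zero_neq_numeral)
  then show False
    using 3 by (simp add: eord_def flip: enat_numeral split: if_splits)
qed

theorem theorem7p3:
  fixes E :: "(4, 'v::real_vector) vbundle"
    and h :: "torus \<Rightarrow> 'v \<Rightarrow> 'v \<Rightarrow> real"
    and hh :: "torus \<Rightarrow> 'v ext2 \<Rightarrow> 'v ext2 \<Rightarrow> real"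
    and D :: "vfield \<Rightarrow> (torus \<Rightarrow> 'v) \<Rightarrow> torus \<Rightarrow> 'v"
    and DD :: "vfield \<Rightarrow> (torus \<Rightarrow> 'v ext2) \<Rightarrow> torus \<Rightarrow> 'v ext2"
    and \<epsilon> :: real
    and \<omega> :: "3 \<Rightarrow> 'v ext2"
    and C1 C2 :: "real^3^3"
  assumes "oriented_vector_bundle E"
    and "bundle_metric E h"
    and "induced_metric E h hh"
    and "\<epsilon> \<in> {1, -1}"
    and "half_positive_onb E h hh \<epsilon> (pr (0, 0)) \<omega>"
    and "metric_connection E h D"
    and "induced_connection E D DD"
    and "C1 \<in> topological_holonomy_group E h DD \<epsilon> \<omega>"
    and "C2 \<in> topological_holonomy_group E h DD \<epsilon> \<omega>"
    and "C1 ** C2 \<noteq> C2 ** C1"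
    and "\<infinity> = eord C1" and "eord C1 \<ge> eord C2" and "eord C2 \<ge> 3"
  shows "topological_holonomy_group E h DD \<epsilon> \<omega> \<subseteq> carrier SO3 \<and>
    (top_of_set (carrier SO3)) closure_of (topological_holonomy_group E h DD \<epsilon> \<omega>) = carrier SO3"
proof -
  define G where "G = topological_holonomy_group E h DD \<epsilon> \<omega>"
  have "holonomy_matrix E h DD \<epsilon> \<omega> c \<subseteq> carrier SO3" for c
    by (auto simp: holonomy_matrix_def)
  then have G: "subgroup G SO3"
    unfolding G_def topological_holonomy_group_def
    by (intro group.generate_is_subgroup[OF group_SO3]) auto
  then have sub: "G \<subseteq> carrier SO3"
    by (rule subgroup.subset)
  have C: "C1 \<in> G" "C2 \<in> G"
    using assms by (simp_all add: G_def)
  have "group.ord SO3 C1 = 0"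
    using \<open>\<infinity> = eord C1\<close> by (simp add: eord_def split: if_splits)
  moreover have "C2 ** C2 \<noteq> mat 1"
    using eord_ge_3_imp_square_neq_1 sub C \<open>eord C2 \<ge> 3\<close> by blast
  ultimately have "closure G = carrier SO3"
    using dense_subgroup_SO3[OF G] C \<open>C1 ** C2 \<noteq> C2 ** C1\<close> by blast
  then show ?thesis
    using sub unfolding G_def[symmetric] by (simp add: closure_of_subtopology Int_absorb1)
qed

end
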